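(* Let $1\le p\le\infty$, $m\in\mathbb{N}$, $n_1,\ldots,n_m\in\mathbb{N}$ (positive integers), let $Q_i=2n_i+2$ for $1\le i\le m$, and let $\varphi:[0,1]^m\to[0,\infty)$ be a nonnegative measurable function. Then the weighted Cesàro operator $\mathcal{P}^*_{\varphi,m}$ is bounded on $L^p(\mathbb{H}^{n_1}\times\mathbb{H}^{n_2}\times\cdots\times\mathbb{H}^{n_m})$ if and only if $$\int_0^1\cdots\int_0^1 t_1^{-Q_1(1-1/p)}\cdots t_m^{-Q_m(1-1/p)}\,\varphi(t_1,\ldots,t_m)\,dt_1\cdots dt_m<\infty,$$ where $1/p$ is read as $0$ when $p=\infty$.
   Context: For a positive integer $n$, the Heisenberg group $\mathbb{H}^n$ is the manifold $\mathbb{R}^{2n+1}$ with group law $$x\circ y=\Big(x_1+y_1,\ldots,x_{2n}+y_{2n},\,x_{2n+1}+y_{2n+1}+2\sum_{j=1}^n(y_jx_{n+j}-x_jy_{n+j})\Big),$$ with Haar measure equal to Lebesgue measure on $\mathbb{R}^{2n+1}$, dilations $$\delta_r(x_1,\ldots,x_{2n},x_{2n+1})=(rx_1,\ldots,rx_{2n},r^2x_{2n+1}),\quad r>0,$$ and homogeneous dimension $Q=2n+2$. The product $\mathbb{H}^{n_1}\times\cdots\times\mathbb{H}^{n_m}$ carries the product (Lebesgue) measure. For a nonnegative measurable function $f$ on $\mathbb{H}^{n_1}\times\cdots\times\mathbb{H}^{n_m}$, the weighted Cesàro operator is $$\mathcal{P}^*_{\varphi,m}(f)(x)=\int_0^1\cdots\int_0^1\frac{f(\delta_{t_1^{-1}}x_1,\ldots,\delta_{t_m^{-1}}x_m)\,\varphi(t_1,\ldots,t_m)}{t_1^{Q_1}\cdots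 t_m^{Q_m}}\,dt_1\cdots dt_m,$$ for $x=(x_1,\ldots,x_m)\in\mathbb{H}^{n_1}\times\cdots\times\mathbb{H}^{n_m}$ (with value in $[0,\infty]$), where $Q_i=2n_i+2$ and $\delta_{t_i^{-1}}$ acts on $\mathbb{H}^{n_i}$. Boundedness on $L^p$ means that there is a finite constant $C$ with $\|\mathcal{P}^*_{\varphi,m}(f)\|_{L^p}\le C\|f\|_{L^p}$ for every nonnegative $f\in L^p(\mathbb{H}^{n_1}\times\cdots\times\mathbb{H}^{n_m})$. *)

theory Defs
  imports "HOL-Analysis.Analysis" "HOL-Probability.Essential_Supremum" "HOL-Algebra.Group"
begin

text \<open>
  Points of the Heisenberg group of order \<open>n\<close> are extensional functions on \<open>{..<2 * n + 1}\<close>.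
  Coordinates are numbered from \<open>0\<close>, so that the central coordinate has index \<open>2 * n\<close>.
\<close>

definition heisenberg :: "nat \<Rightarrow> (nat \<Rightarrow> real) monoid" where
  "heisenberg n =
     \<lparr>carrier = {..<2 * n + 1} \<rightarrow>\<^sub>E UNIV,
      mult = (\<lambda>x y. \<lambda>j\<in>{..<2 * n + 1}.
                if j < 2 * n then x j + y j
                else x j + y j + 2 * (\<Sum>k<n. y k * x (n + k) - x k * y (n + k))),
      one = (\<lambda>j\<in>{..<2 * n + 1}. 0)\<rparr>"

definition dilation :: "nat \<Rightarrow> real \<Rightarrow> (nat \<Rightarrow> real) \<Rightarrow> nat \<Rightarrow> real" where
  "dilation n r x = (\<lambda>j\<in>{..<2 * n + 1}. if j < 2 * n then r * x j else r\<^sup>2 * x j)"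

definition hom_dim :: "nat \<Rightarrow> nat" where
  "hom_dim n = 2 * n + 2"

text \<open>
  The product of the Heisenberg groups of orders \<open>n 0, \<dots>, n (m - 1)\<close> with Lebesgue measure,
  and the unit cube with Lebesgue measure. Both are completed, so that measurability means
  Lebesgue measurability.
\<close>

definition heis_prod :: "nat \<Rightarrow> (nat \<Rightarrow> nat) \<Rightarrow> (nat \<Rightarrow> nat \<Rightarrow> real) measure" where
  "heis_prod m n = completion (\<Pi>\<^sub>M i\<in>{..<m}. \<Pi>\<^sub>M j\<in>{..<2 * n i + 1}. lborel)"

definition unit_cube :: "nat \<Rightarrow> (nat \<Rightarrow> real) measure" where
  "unit_cube m =
     restrict_space (completion (\<Pi>\<^sub>M i\<in>{..<m}. lborel)) ({..<m} \<rightarrow>\<^sub>E {0..1})"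

text \<open>
  Some \<open>t i\<close> vanishes only on a null set of the cube, so the values that division by zero
  assigns to the integrand there are irrelevant.
\<close>

definition cesaro ::
    "nat \<Rightarrow> (nat \<Rightarrow> nat) \<Rightarrow> ((nat \<Rightarrow> real) \<Rightarrow> real) \<Rightarrow>
     ((nat \<Rightarrow> nat \<Rightarrow> real) \<Rightarrow> real) \<Rightarrow> (nat \<Rightarrow> nat \<Rightarrow> real) \<Rightarrow> ennreal" where
  "cesaro m n \<phi> f x =
     (\<integral>\<^sup>+ t. ennreal (f (\<lambda>i\<in>{..<m}. dilation (n i) (inverse (t i)) (x i)) * \<phi> t
                    / (\<Prod>i<m. t i ^ hom_dim (n i))) \<partial>unit_cube m)"

definition ennreal_powr :: "ennreal \<Rightarrow> real \<Rightarrow> ennreal" where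
  "ennreal_powr y a = (if y = \<infinity> then \<infinity> else ennreal (enn2real y powr a))"
  \<comment> \<open>only used with \<open>a > 0\<close>\<close>

definition exponent_recip :: "ennreal \<Rightarrow> real" where
  "exponent_recip p = (if p = \<infinity> then 0 else 1 / enn2real p)"

definition Lp_norm :: "ennreal \<Rightarrow> 'a measure \<Rightarrow> ('a \<Rightarrow> ennreal) \<Rightarrow> ennreal" where
  "Lp_norm p M g =
     (if p = \<infinity> then esssup M g
      else ennreal_powr (\<integral>\<^sup>+ x. ennreal_powr (g x) (enn2real p) \<partial>M) (1 / enn2real p))"

definition Lp_nonneg :: "ennreal \<Rightarrow> 'a measure \<Rightarrow> ('a \<Rightarrow> real) set" where
  "Lp_nonneg p M =
     {f \<in> borel_measurable M. (\<forall>x\<in>space M. 0 \<le> f x) \<and> Lp_norm p M (\<lambda>x. ennreal (f x)) < \<infinity>}"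

definition Lp_bounded ::
    "ennreal \<Rightarrow> 'a measure \<Rightarrow> (('a \<Rightarrow> real) \<Rightarrow> 'a \<Rightarrow> ennreal) \<Rightarrow> bool" where
  "Lp_bounded p M T \<longleftrightarrow>
     (\<exists>C<\<infinity>. \<forall>f\<in>Lp_nonneg p M. Lp_norm p M (T f) \<le> C * Lp_norm p M (\<lambda>x. ennreal (f x)))"

lemma group_heisenberg: "group (heisenberg n)"
proof (rule groupI)
  fix x y z
  assume "x \<in> carrier (heisenberg n)" "y \<in> carrier (heisenberg n)" "z \<in> carrier (heisenberg n)"
  show "x \<otimes>\<^bsub>heisenberg n\<^esub> y \<otimes>\<^bsub>heisenberg n\<^esub> z = x \<otimes>\<^bsub>heisenberg n\<^esub> (y \<otimes>\<^bsub>heisenberg n\<^esub> z)"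
    by (auto simp: heisenberg_def restrict_def fun_eq_iff algebra_simps sum.distrib sum_subtractf)
next
  fix x
  assume x: "x \<in> carrier (heisenberg n)"
  have "(\<lambda>j\<in>{..<2 * n + 1}. - x j) \<otimes>\<^bsub>heisenberg n\<^esub> x = \<one>\<^bsub>heisenberg n\<^esub>"
    by (auto simp: heisenberg_def restrict_def fun_eq_iff algebra_simps sum.distrib sum_subtractf)
  moreover have "(\<lambda>j\<in>{..<2 * n + 1}. - x j) \<in> carrier (heisenberg n)"
    by (simp add: heisenberg_def)
  ultimately show "\<exists>y\<in>carrier (heisenberg n). y \<otimes>\<^bsub>heisenberg n\<^esub> x = \<one>\<^bsub>heisenberg n\<^esub>"
    by blast
qed (auto simp: heisenberg_def restrict_def fun_eq_iff PiE_def extensional_def)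

lemma dilation_hom: "dilation n r \<in> hom (heisenberg n) (heisenberg n)"
  by (auto simp: hom_def heisenberg_def dilation_def restrict_def fun_eq_iff algebra_simps
      power2_eq_square sum_distrib_left)

lemma space_heis_prod: "space (heis_prod m n) = (\<Pi>\<^sub>E i\<in>{..<m}. carrier (heisenberg (n i)))"
  by (simp add: heis_prod_def heisenberg_def space_PiM)

lemma space_unit_cube: "space (unit_cube m) = {..<m} \<rightarrow>\<^sub>E {0..1}"
  by (auto simp: unit_cube_def space_restrict_space space_PiM)

end

theory Submission
  imports Defs
begin

text \<open>
  Let \<open>J t = \<Prod>i. t i ^ Q i\<close> be the Jacobian of \<open>x \<mapsto> (\<delta>\<^bsub>t i\<^esub> x i)\<^sub>i\<close>, so that the operator is the
  average of \<open>f \<circ> \<delta>\<^bsub>1/t\<^esub>\<close> against the kernel \<open>K = \<phi> / J\<close>, and the integral in the criterion is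
  \<open>W (1/p)\<close>, where \<open>W a = \<integral> K J\<^sup>a\<close>.

  Sufficiency: for \<open>p < \<infinity>\<close>, Jensen's inequality with respect to the finite measure \<open>K J\<^bsup>1/p\<^esup> dt\<close>,
  followed by Tonelli and the change of variables \<open>x \<mapsto> \<delta>\<^bsub>1/t\<^esub> x\<close>, bounds the operator norm by
  \<open>W (1/p)\<close>. For \<open>p = \<infinity>\<close> the bound is immediate.

  Necessity: the function \<open>f\<^sub>a x = \<Prod>i j. (1 + \<bar>x i j\<bar>)\<^bsup>-a\<^esup>\<close> satisfies
  \<open>f\<^sub>a (\<delta>\<^bsub>1/t\<^esub> x) \<ge> (J t)\<^sup>a f\<^sub>a x\<close> for \<open>t \<in> (0, 1]\<^sup>m\<close>, so that \<open>f\<^sub>a\<close> is mapped to a function above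
  \<open>W a f\<^sub>a\<close>. It lies in \<open>L\<^sup>p\<close> for \<open>a > 1/p\<close>, which gives \<open>W a \<le> C\<close>, and Fatou's lemma for
  \<open>a \<rightarrow> 1/p\<close> finishes the proof. For \<open>p = \<infinity>\<close> take \<open>a = 0\<close>.
\<close>

subsection \<open>Powers and Jensen's inequality in the extended nonnegative reals\<close>

lemma ennreal_powr_ennreal [simp]: "0 \<le> x \<Longrightarrow> ennreal_powr (ennreal x) a = ennreal (x powr a)"
  by (simp add: ennreal_powr_def)

lemma ennreal_powr_0 [simp]: "ennreal_powr 0 a = 0"
  by (simp add: ennreal_powr_def)

lemma ennreal_powr_top [simp]: "ennreal_powr Orderings.top a = Orderings.top"
  by (simp add: ennreal_powr_def)

lemma ennreal_powr_mono:
  assumes "x \<le> y" "0 \<le> a" shows "ennreal_powr x a \<le> ennreal_powr y a"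
  using assms by (cases x; cases y) (auto intro!: ennreal_leI powr_mono2 simp: top_unique)

lemma ennreal_powr_eq_0_iff [simp]: "ennreal_powr x a = 0 \<longleftrightarrow> x = 0"
  by (cases x) (auto simp: ennreal_eq_0_iff)

text \<open>\<open>ennreal_powr\<close> fixes 0 and \<infinity> for every real exponent, so the
  degenerate products agree under the convention 0 * \<infinity> = 0.\<close>

lemma ennreal_powr_mult:
  "ennreal_powr (x * y) a = ennreal_powr x a * ennreal_powr y a"
proof (cases "x = 0 \<or> y = 0")
  case True
  then show ?thesis by auto
next
  case False
  then show ?thesis
    by (cases x; cases y)
       (auto simp: ennreal_mult[symmetric] powr_mult ennreal_mult_eq_top_iff ennreal_top_mult ennreal_mult_top)
qed

lemma ennreal_powr_powr_inverse:
  assumes "0 < a" shows "ennreal_powr (ennreal_powr x a) (1 / a) = x"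
  using assms by (cases x) (auto simp: powr_powr)

lemma measurable_ennreal_powr [measurable]:
  "(\<lambda>x. ennreal_powr x a) \<in> borel_measurable borel"
  unfolding ennreal_powr_def by measurable

text \<open>Minimising the right-hand side over \<open>s\<close> after integration turns this into Jensen's inequality.\<close>
lemma ennreal_tangent_le:
  fixes g :: ennreal and p s :: real
  assumes p: "1 \<le> p" and s: "0 < s"
  shows "g \<le> ennreal (s powr (1 - p) / p) * ennreal_powr g p + ennreal ((1 - 1 / p) * s)"
proof (cases g)
  case (real r)
  show ?thesis
  proof (cases "r = 0")
    case False
    then have r: "0 < r" using real by simp
    \<comment> \<open>Young's inequality for r^p and s^p with weights 1/p and 1 - 1/p. After
      multiplication by s^(1-p) it says that the concave function u^(1/p) lies below its tangent at
      u = s^p.\<close>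
    have "(r powr p) powr (1 / p) * (s powr p) powr (1 - 1 / p) \<le> 1 / p * r powr p + (1 - 1 / p) * s powr p"
      using p r s by (intro Youngs_inequality_0) auto
    also have "(r powr p) powr (1 / p) * (s powr p) powr (1 - 1 / p) = r * s powr (p - 1)"
      using p r s by (simp add: powr_powr algebra_simps)
    finally have "r * s powr (p - 1) * s powr (1 - p)
        \<le> (1 / p * r powr p + (1 - 1 / p) * s powr p) * s powr (1 - p)"
      by (rule mult_right_mono) simp
    then have "r * (s powr (p - 1) * s powr (1 - p))
        \<le> s powr (1 - p) / p * r powr p + (1 - 1 / p) * (s powr p * s powr (1 - p))"
      by (simp add: algebra_simps)
    then have "r \<le> s powr (1 - p) / p * r powr p + (1 - 1 / p) * s"
      using s by (simp flip: powr_add)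
    then show ?thesis
      using real p s by (simp add: ennreal_mult[symmetric] ennreal_plus[symmetric] del: ennreal_plus)
  qed (use real in simp)
next
  case top
  have "0 < s powr (1 - p) / p" using p s by simp
  then have "ennreal (s powr (1 - p) / p) \<noteq> 0" by (simp only: ennreal_eq_0_iff not_le)
  then show ?thesis
    using top by (simp add: ennreal_mult_top del: ennreal_eq_0_iff)
qed

text \<open>Jensen's inequality for r^p against the density \<open>K\<close>, whose total mass w is
  not normalised; hence the factor w^(p-1). The integrated tangent inequality is sharpest at s =
  (a/w)^(1/p), where a is the integral of \<open>K t * ennreal_powr (g t) p\<close>.\<close>

lemma nn_integral_powr_le:
  assumes K[measurable]: "K \<in> borel_measurable M" and g[measurable]: "g \<in> borel_measurable M"
    and W: "(\<integral>\<^sup>+ t. K t \<partial>M) < \<infinity>" and p: "1 \<le> p"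
  shows "ennreal_powr (\<integral>\<^sup>+ t. K t * g t \<partial>M) p \<le>
    ennreal_powr (\<integral>\<^sup>+ t. K t \<partial>M) (p - 1) * (\<integral>\<^sup>+ t. K t * ennreal_powr (g t) p \<partial>M)"
proof -
  obtain w where w: "(\<integral>\<^sup>+ t. K t \<partial>M) = ennreal w" "0 \<le> w"
    using W by (cases "\<integral>\<^sup>+ t. K t \<partial>M") auto
  consider "w = 0" | "0 < w" "(\<integral>\<^sup>+ t. K t * ennreal_powr (g t) p \<partial>M) = \<infinity>"
    | a where "0 < w" "(\<integral>\<^sup>+ t. K t * ennreal_powr (g t) p \<partial>M) = ennreal a" "0 \<le> a"
    using w by (cases "\<integral>\<^sup>+ t. K t * ennreal_powr (g t) p \<partial>M") force+
  then show ?thesis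
  proof cases
    case 1
    then have "AE t in M. K t = 0"
      using w by (subst nn_integral_0_iff_AE[symmetric]) auto
    then have "(\<integral>\<^sup>+ t. K t * g t \<partial>M) = 0"
      by (subst nn_integral_0_iff_AE) auto
    then show ?thesis by simp
  next
    case 2
    then show ?thesis using w by (simp add: ennreal_mult_top)
  next
    case 3
    \<comment> \<open>The optimal \<open>s\<close> is 0 when \<open>a = 0\<close>, but the tangent
      inequality asks for \<open>0 < s\<close>. All larger \<open>s\<close> are therefore treated,
      and \<open>dense_ge\<close> passes to the limit below.\<close>
    have bound: "(\<integral>\<^sup>+ t. K t * g t \<partial>M) \<le> ennreal (s * w)" if s: "(a / w) powr (1 / p) < s" for s
    proof -
      have s0: "0 < s" using s by (rule le_less_trans[rotated]) simp
      have "((a / w) powr (1 / p)) powr p \<le> s powr p"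
        using s p by (intro powr_mono2) auto
      then have "a / w \<le> s powr p"
        using p 3 by (simp add: powr_powr)
      then have "a \<le> s powr p * w"
        using 3 by (simp add: field_simps)
      then have "s powr (1 - p) * a \<le> s powr (1 - p) * (s powr p * w)"
        by (intro mult_left_mono) auto
      also have "\<dots> = s * w"
        using s0 by (simp add: powr_add[symmetric] mult.assoc[symmetric])
      finally have sa: "s powr (1 - p) * a \<le> s * w" .
      have "(\<integral>\<^sup>+ t. K t * g t \<partial>M) \<le>
        (\<integral>\<^sup>+ t. K t * (ennreal (s powr (1 - p) / p) * ennreal_powr (g t) p + ennreal ((1 - 1 / p) * s)) \<partial>M)"
        by (intro nn_integral_mono mult_left_mono ennreal_tangent_le p s0) simp
      also have "\<dots> = (\<integral>\<^sup>+ t. ennreal (s powr (1 - p) / p) * (K t * ennreal_powr (g t) p)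
          + ennreal ((1 - 1 / p) * s) * K t \<partial>M)"
        by (simp add: algebra_simps)
      also have "\<dots> = ennreal (s powr (1 - p) / p) * ennreal a + ennreal ((1 - 1 / p) * s) * ennreal w"
        by (subst nn_integral_add) (auto simp: nn_integral_cmult 3 w)
      also have "\<dots> = ennreal (s powr (1 - p) * a / p + (1 - 1 / p) * s * w)"
        using p s0 3 by (simp add: ennreal_mult[symmetric] ennreal_plus[symmetric] del: ennreal_plus)
      also have "\<dots> \<le> ennreal (s * w / p + (1 - 1 / p) * s * w)"
        using p sa by (intro ennreal_leI add_right_mono divide_right_mono) auto
      also have "\<dots> = ennreal (s * w)"
        by (simp add: algebra_simps)
      finally show ?thesis .
    qed
    obtain I where I: "(\<integral>\<^sup>+ t. K t * g t \<partial>M) = ennreal I" "0 \<le> I"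
      using bound[OF less_add_one] by (cases "\<integral>\<^sup>+ t. K t * g t \<partial>M") (auto simp: top_unique)
    have "I / w \<le> (a / w) powr (1 / p)"
    proof (rule dense_ge)
      fix s assume s: "(a / w) powr (1 / p) < s"
      have "0 < s" using s by (rule le_less_trans[rotated]) simp
      then show "I / w \<le> s"
        using bound[OF s] I 3 by (simp add: ennreal_le_iff field_simps)
    qed
    then have "(I / w) powr p \<le> ((a / w) powr (1 / p)) powr p"
      using p I 3 by (intro powr_mono2) auto
    also have "\<dots> = a / w"
      using p 3 by (simp add: powr_powr)
    finally have "I powr p \<le> a / w * w powr p"
      using I 3 by (simp add: powr_divide field_simps)
    also have "\<dots> = w powr (p - 1) * a"
      using 3 by (simp add: powr_diff)
    finally show ?thesis
      using I w 3 by (simp add: ennreal_mult[symmetric])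
  qed
qed

subsection \<open>Averages over families of dilations\<close>

text \<open>Preimages under \<open>f\<close> and \<open>g\<close> differ by a subset of a null set,
  and such sets are measurable in the completion.\<close>

lemma borel_measurable_completion_AE:
  assumes f: "f \<in> measurable (completion M) N" and g: "\<And>x. x \<in> space M \<Longrightarrow> g x \<in> space N"
    and ae: "AE x in M. f x = g x"
  shows "g \<in> measurable (completion M) N"
proof (rule measurableI)
  fix A assume A: "A \<in> sets N"
  have "AE x in completion M. x \<in> f -` A \<inter> space (completion M) \<longleftrightarrow> x \<in> g -` A \<inter> space (completion M)"
    using ae by (intro AE_completion) auto
  then show "g -` A \<inter> space (completion M) \<in> sets (completion M)"
    by (rule completion.in_sets_AE) (use measurable_sets[OF f A] in auto)
qed (use g in simp)

section \<open>Monotonicity and homogeneity of L^p norms for finite p\<close>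

lemma Lp_norm_mono_AE:
  assumes "AE x in M. f x \<le> g x" "p \<noteq> \<infinity>"
  shows "Lp_norm p M f \<le> Lp_norm p M g"
  using assms unfolding Lp_norm_def
  by (auto intro!: ennreal_powr_mono nn_integral_mono_AE elim!: eventually_mono)

lemma Lp_norm_cmult:
  assumes "f \<in> borel_measurable M" "p \<noteq> \<infinity>" "1 \<le> p"
  shows "Lp_norm p M (\<lambda>x. c * f x) = c * Lp_norm p M f"
proof -
  have "0 < enn2real p"
    using assms by (cases p) auto
  then show ?thesis
    using assms unfolding Lp_norm_def
    by (simp add: ennreal_powr_mult nn_integral_cmult ennreal_powr_powr_inverse)
qed

text \<open>Abstract form of the operator: \<open>D t\<close> plays the dilation by 1/t, and
  \<open>J t\<close> is the factor by which it multiplies the measure of preimages. Scaling is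
  imposed only where \<open>K t\<close> is nonzero, because the dilation degenerates when a
  coordinate of t is 0. In the application \<open>M\<close> is the uncompleted measure, so that
  \<open>D\<close> is jointly measurable and Tonelli applies.\<close>

locale dilation_average = pair_sigma_finite U M
  for U :: "'b measure" and M :: "'a measure" +
  fixes D :: "'b \<Rightarrow> 'a \<Rightarrow> 'a" and K :: "'b \<Rightarrow> ennreal" and J :: "'b \<Rightarrow> real"
  assumes D: "(\<lambda>(t, x). D t x) \<in> measurable (U \<Otimes>\<^sub>M M) M"
    and K [measurable]: "K \<in> borel_measurable U"
    and J [measurable]: "J \<in> borel_measurable U"
    and J_pos: "\<And>t. t \<in> space U \<Longrightarrow> K t \<noteq> 0 \<Longrightarrow> 0 < J t"
    and emeasure_D: "\<And>t A. t \<in> space U \<Longrightarrow> K t \<noteq> 0 \<Longrightarrow> A \<in> sets M \<Longrightarrow>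
      emeasure M (D t -` A \<inter> space M) = ennreal (J t) * emeasure M A"
begin

definition average :: "('a \<Rightarrow> ennreal) \<Rightarrow> 'a \<Rightarrow> ennreal" where
  "average f x = (\<integral>\<^sup>+ t. K t * f (D t x) \<partial>U)"

definition operator_bound :: "real \<Rightarrow> ennreal" where
  "operator_bound a = (\<integral>\<^sup>+ t. K t * ennreal (J t powr a) \<partial>U)"

section \<open>Change of variables, null sets and measurability of averages\<close>

lemma measurable_D [measurable (raw)]:
  assumes "g \<in> measurable N U" "h \<in> measurable N M"
  shows "(\<lambda>x. D (g x) (h x)) \<in> measurable N M"
  using measurable_compose[OF measurable_Pair[OF assms] D] by simp

lemma measurable_D_fixed: "t \<in> space U \<Longrightarrow> D t \<in> measurable M M"
  using measurable_compose_Pair1[OF _ D, of t] by simp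

text \<open>Change of variables: the push-forward of \<open>M\<close> under \<open>D t\<close> is
  \<open>M\<close> scaled by \<open>J t\<close>.\<close>

lemma nn_integral_D:
  assumes t: "t \<in> space U" "K t \<noteq> 0" and f: "f \<in> borel_measurable M"
  shows "(\<integral>\<^sup>+ x. f (D t x) \<partial>M) = ennreal (J t) * (\<integral>\<^sup>+ x. f x \<partial>M)"
proof -
  have "distr M M (D t) = scale_measure (ennreal (J t)) M"
    using t by (intro measure_eqI) (auto simp: emeasure_distr emeasure_D measurable_D_fixed)
  then have "(\<integral>\<^sup>+ x. f x \<partial>distr M M (D t)) = ennreal (J t) * (\<integral>\<^sup>+ x. f x \<partial>M)"
    using f by (simp add: nn_integral_scale_measure)
  then show ?thesis
    using t f by (simp add: nn_integral_distr measurable_D_fixed)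
qed

text \<open>For fixed t with \<open>K t\<close> nonzero, the preimage of a null set under
  \<open>D t\<close> is null by scaling; Tonelli then exchanges the two almost-everywhere
  quantifiers.\<close>

lemma AE_D:
  assumes ae: "AE x in M. P x"
  shows "AE x in M. AE t in U. K t \<noteq> 0 \<longrightarrow> P (D t x)"
proof -
  \<comment> \<open>The exceptional set of \<open>P\<close> may be non-measurable, so it is enclosed
    in a measurable null set; the exchange of quantifiers requires a measurable condition.\<close>
  obtain N where N: "N \<in> null_sets M" "{x \<in> space M. \<not> P x} \<subseteq> N"
    using AE_E[OF ae] by (metis null_setsI)
  have [measurable]: "N \<in> sets M" using N by auto
  have "AE t in U. AE x in M. K t \<noteq> 0 \<longrightarrow> D t x \<notin> N"
  proof (rule AE_I2)
    fix t assume t: "t \<in> space U"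
    show "AE x in M. K t \<noteq> 0 \<longrightarrow> D t x \<notin> N"
    proof (cases "K t = 0")
      case False
      then have "emeasure M (D t -` N \<inter> space M) = 0"
        using N t by (simp add: emeasure_D null_setsD1)
      moreover have "D t -` N \<inter> space M \<in> sets M"
        using measurable_sets[OF measurable_D_fixed[OF t]] N by auto
      ultimately have "D t -` N \<inter> space M \<in> null_sets M"
        by auto
      then show ?thesis
        by (rule AE_I') auto
    qed simp
  qed
  moreover have "(AE t in U. AE x in M. K t \<noteq> 0 \<longrightarrow> D t x \<notin> N) \<longleftrightarrow>
      (AE x in M. AE t in U. K t \<noteq> 0 \<longrightarrow> D t x \<notin> N)"
    by (rule AE_commute) measurable
  ultimately have "AE x in M. AE t in U. K t \<noteq> 0 \<longrightarrow> D t x \<notin> N"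
    by simp
  with AE_space show ?thesis
  proof eventually_elim
    case (elim x)
    show ?case
      using elim(2) AE_space
    proof eventually_elim
      case (elim t)
      then show ?case
        using N(2) measurable_space[OF measurable_D_fixed[of t] \<open>x \<in> space M\<close>] by auto
    qed
  qed
qed

text \<open>Makes the operator well defined on almost-everywhere classes, so that a Lebesgue
  measurable function can be replaced by a Borel one.\<close>

lemma average_cong_AE:
  assumes "AE x in M. f x = g x"
  shows "AE x in M. average f x = average g x"
  using AE_D[OF assms] unfolding average_def
proof (rule eventually_mono)
  fix x assume "AE t in U. K t \<noteq> 0 \<longrightarrow> f (D t x) = g (D t x)"
  then have "AE t in U. K t * f (D t x) = K t * g (D t x)"
    by eventually_elim auto
  then show "(\<integral>\<^sup>+ t. K t * f (D t x) \<partial>U) = (\<integral>\<^sup>+ t. K t * g (D t x) \<partial>U)"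
    by (rule nn_integral_cong_AE)
qed

lemma measurable_average [measurable]:
  assumes [measurable]: "f \<in> borel_measurable M"
  shows "average f \<in> borel_measurable M"
  unfolding average_def[abs_def] by measurable

text \<open>For \<open>f\<close> measurable only in the completion, joint measurability of
  \<open>f (D t x)\<close> is not at hand. The average of a Borel representative is measurable and
  agrees almost everywhere.\<close>

lemma measurable_average_completion:
  assumes f: "f \<in> borel_measurable (completion M)"
  shows "average f \<in> borel_measurable (completion M)"
proof -
  obtain g where g: "g \<in> borel_measurable M" "AE x in M. f x = g x"
    using completion_ex_borel_measurable[OF f] by blast
  have "AE x in M. average g x = average f x"
    using average_cong_AE[OF g(2)] by eventually_elim simp
  then show ?thesis
    by (rule borel_measurable_completion_AE[rotated 2]) (use g in \<open>auto intro: measurable_completion\<close>)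
qed

text \<open>The average is split into the weight \<open>w = K J^(1/p)\<close> and the integrand
  J^(-1/p) f(D t x). Jensen with weight \<open>w\<close> raises the second factor to the power p,
  and the resulting 1/J cancels the Jacobian of the change of variables.\<close>

lemma nn_integral_average_powr_le:
  assumes p: "1 \<le> p" and W: "operator_bound (1 / p) < \<infinity>" and f [measurable]: "f \<in> borel_measurable M"
  shows "(\<integral>\<^sup>+ x. ennreal_powr (average f x) p \<partial>M) \<le>
    ennreal_powr (operator_bound (1 / p)) p * (\<integral>\<^sup>+ x. ennreal_powr (f x) p \<partial>M)"
proof -
  define w where "w t = K t * ennreal (J t powr (1 / p))" for t
  have [measurable]: "w \<in> borel_measurable U" unfolding w_def by measurable
  have Ww: "operator_bound (1 / p) = (\<integral>\<^sup>+ t. w t \<partial>U)"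
    by (simp add: operator_bound_def w_def)
  have "ennreal_powr (average f x) p \<le>
      ennreal_powr (operator_bound (1 / p)) (p - 1) * (\<integral>\<^sup>+ t. w t * ennreal_powr (ennreal (J t powr (- 1 / p)) * f (D t x)) p \<partial>U)"
    if [measurable]: "x \<in> space M" for x
  proof -
    have "average f x = (\<integral>\<^sup>+ t. w t * (ennreal (J t powr (- 1 / p)) * f (D t x)) \<partial>U)"
      unfolding average_def
    proof (rule nn_integral_cong)
      fix t assume "t \<in> space U"
      then have "ennreal (J t powr (1 / p)) * ennreal (J t powr (- 1 / p)) = 1" if "K t \<noteq> 0"
        using J_pos[of t] that by (simp add: ennreal_mult[symmetric] powr_add[symmetric])
      then show "K t * f (D t x) = w t * (ennreal (J t powr (- 1 / p)) * f (D t x))"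
        unfolding w_def by (cases "K t = 0") (simp_all add: mult.assoc flip: mult.assoc[of _ _ "f (D t x)"])
    qed
    then show ?thesis
      unfolding Ww using W p that by (auto simp: Ww intro!: nn_integral_powr_le)
  qed
  then have "(\<integral>\<^sup>+ x. ennreal_powr (average f x) p \<partial>M) \<le>
      (\<integral>\<^sup>+ x. ennreal_powr (operator_bound (1 / p)) (p - 1) *
        (\<integral>\<^sup>+ t. w t * ennreal_powr (ennreal (J t powr (- 1 / p)) * f (D t x)) p \<partial>U) \<partial>M)"
    by (rule nn_integral_mono)
  also have "\<dots> = ennreal_powr (operator_bound (1 / p)) (p - 1) *
      (\<integral>\<^sup>+ x. (\<integral>\<^sup>+ t. w t * ennreal_powr (ennreal (J t powr (- 1 / p)) * f (D t x)) p \<partial>U) \<partial>M)"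
    by (rule nn_integral_cmult) measurable
  \<comment> \<open>Tonelli puts the integral over x inside, where the substitution
    \<open>D t\<close> can be made for each t separately.\<close>
  also have "(\<integral>\<^sup>+ x. (\<integral>\<^sup>+ t. w t * ennreal_powr (ennreal (J t powr (- 1 / p)) * f (D t x)) p \<partial>U) \<partial>M) =
      (\<integral>\<^sup>+ t. (\<integral>\<^sup>+ x. w t * ennreal_powr (ennreal (J t powr (- 1 / p)) * f (D t x)) p \<partial>M) \<partial>U)"
    by (rule Fubini') measurable
  also have "\<dots> = (\<integral>\<^sup>+ t. w t * (\<integral>\<^sup>+ x. ennreal_powr (f x) p \<partial>M) \<partial>U)"
  proof (rule nn_integral_cong)
    fix t assume t [measurable]: "t \<in> space U"
    show "(\<integral>\<^sup>+ x. w t * ennreal_powr (ennreal (J t powr (- 1 / p)) * f (D t x)) p \<partial>M) =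
      w t * (\<integral>\<^sup>+ x. ennreal_powr (f x) p \<partial>M)"
    proof (cases "K t = 0")
      case False
      have Jp: "(J t powr (- 1 / p)) powr p = inverse (J t)"
        using J_pos[OF t False] p by (subst powr_powr) (simp add: powr_minus)
      have "(\<integral>\<^sup>+ x. w t * ennreal_powr (ennreal (J t powr (- 1 / p)) * f (D t x)) p \<partial>M) =
          (\<integral>\<^sup>+ x. w t * ennreal (inverse (J t)) * ennreal_powr (f (D t x)) p \<partial>M)"
        using Jp by (simp add: ennreal_powr_mult mult.assoc)
      also have "\<dots> = w t * ennreal (inverse (J t)) * (ennreal (J t) * (\<integral>\<^sup>+ x. ennreal_powr (f x) p \<partial>M))"
        using t False by (subst nn_integral_cmult) (auto simp: nn_integral_D[where f = "\<lambda>x. ennreal_powr (f x) p"])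
      also have "\<dots> = w t * (ennreal (inverse (J t)) * ennreal (J t)) * (\<integral>\<^sup>+ x. ennreal_powr (f x) p \<partial>M)"
        by (simp add: mult.assoc)
      finally show ?thesis
        using J_pos[OF t False] by (simp add: ennreal_mult[symmetric])
    qed (simp add: w_def)
  qed
  also have "\<dots> = operator_bound (1 / p) * (\<integral>\<^sup>+ x. ennreal_powr (f x) p \<partial>M)"
    by (simp add: nn_integral_multc Ww)
  also have "ennreal_powr (operator_bound (1 / p)) (p - 1) * (operator_bound (1 / p) * (\<integral>\<^sup>+ x. ennreal_powr (f x) p \<partial>M)) =
      ennreal_powr (operator_bound (1 / p)) p * (\<integral>\<^sup>+ x. ennreal_powr (f x) p \<partial>M)"
  proof -
    obtain c where c: "operator_bound (1 / p) = ennreal c" "0 \<le> c"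
      using W by (cases "operator_bound (1 / p)") auto
    have "c powr (p - 1) * c = c powr p"
      using c by (cases "c = 0") (auto simp: powr_diff)
    then show ?thesis
      using c by (simp add: mult.assoc[symmetric] ennreal_mult[symmetric])
  qed
  finally show ?thesis .
qed

text \<open>For p = \<infinity>, \<open>AE_D\<close> carries the bound of \<open>f\<close> by its
  essential supremum over to the points \<open>D t x\<close>. For finite p the power estimate is
  applied to a Borel representative and the p-th root is taken.\<close>

lemma Lp_norm_average_le:
  assumes p: "1 \<le> p" and W: "operator_bound (exponent_recip p) < \<infinity>"
    and f: "f \<in> borel_measurable (completion M)"
  shows "Lp_norm p (completion M) (average f) \<le> operator_bound (exponent_recip p) * Lp_norm p (completion M) f"
proof (cases "p = \<infinity>")
  case True
  \<comment> \<open>The exponent is 0 here, and J^0 = 1 because \<open>J t\<close> is positive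
    wherever \<open>K t\<close> is nonzero; \<open>0 powr 0\<close> would be 0.\<close>
  have c: "operator_bound (exponent_recip p) = (\<integral>\<^sup>+ t. K t \<partial>U)"
    unfolding operator_bound_def
  proof (rule nn_integral_cong)
    fix t assume "t \<in> space U"
    then show "K t * ennreal (J t powr exponent_recip p) = K t"
      using True J_pos[of t] by (cases "K t = 0") (simp_all add: exponent_recip_def)
  qed
  define z where "z = esssup (completion M) f"
  have "AE x in M. f x \<le> z"
    using esssup_AE[where M = "completion M" and f = f] by (simp add: z_def AE_completion_iff)
  from AE_D[OF this] have "AE x in M. average f x \<le> operator_bound (exponent_recip p) * z"
  proof (rule eventually_mono)
    fix x assume "AE t in U. K t \<noteq> 0 \<longrightarrow> f (D t x) \<le> z"
    then have "average f x \<le> (\<integral>\<^sup>+ t. K t * z \<partial>U)"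
      unfolding average_def
      by (intro nn_integral_mono_AE, eventually_elim) (auto intro: mult_left_mono)
    then show "average f x \<le> operator_bound (exponent_recip p) * z"
      by (simp add: c nn_integral_multc)
  qed
  then have "esssup (completion M) (average f) \<le> operator_bound (exponent_recip p) * z"
    by (intro esssup_I measurable_average_completion f AE_completion)
  then show ?thesis
    using True by (simp add: Lp_norm_def z_def)
next
  case False
  define q where "q = enn2real p"
  have q: "1 \<le> q" using p False unfolding q_def by (cases p) auto
  have r: "exponent_recip p = 1 / q" using False by (simp add: exponent_recip_def q_def)
  obtain g where g: "g \<in> borel_measurable M" "AE x in M. f x = g x"
    using completion_ex_borel_measurable[OF f] by blast
  have "(\<integral>\<^sup>+ x. ennreal_powr (average f x) q \<partial>M) = (\<integral>\<^sup>+ x. ennreal_powr (average g x) q \<partial>M)"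
    using average_cong_AE[OF g(2)] by (intro nn_integral_cong_AE, eventually_elim) simp
  also have "\<dots> \<le> ennreal_powr (operator_bound (1 / q)) q * (\<integral>\<^sup>+ x. ennreal_powr (g x) q \<partial>M)"
    using q W r g by (intro nn_integral_average_powr_le) auto
  also have "(\<integral>\<^sup>+ x. ennreal_powr (g x) q \<partial>M) = (\<integral>\<^sup>+ x. ennreal_powr (f x) q \<partial>M)"
    using g(2) by (intro nn_integral_cong_AE, eventually_elim) simp
  finally have "ennreal_powr (\<integral>\<^sup>+ x. ennreal_powr (average f x) q \<partial>M) (1 / q) \<le>
      ennreal_powr (ennreal_powr (operator_bound (1 / q)) q * (\<integral>\<^sup>+ x. ennreal_powr (f x) q \<partial>M)) (1 / q)"
    using q by (intro ennreal_powr_mono) auto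
  also have "\<dots> = operator_bound (1 / q) * ennreal_powr (\<integral>\<^sup>+ x. ennreal_powr (f x) q \<partial>M) (1 / q)"
    using q by (subst ennreal_powr_mult) (simp add: ennreal_powr_powr_inverse)
  finally show ?thesis
    using False by (simp add: Lp_norm_def q_def[symmetric] r nn_integral_completion)
qed

end

subsection \<open>Dilations of products of Heisenberg groups\<close>

text \<open>The preimage of a box is a box, and a product measure is determined by its values on
  boxes. It serves twice: for the coordinates of one group and for the factors of the
  product.\<close>

lemma (in product_sigma_finite) emeasure_PiM_map:
  assumes I: "finite I"
    and T [measurable]: "\<And>i. i \<in> I \<Longrightarrow> T i \<in> measurable (M i) (M i)"
    and c: "\<And>i. i \<in> I \<Longrightarrow> 0 < c i"
    and scale: "\<And>i A. i \<in> I \<Longrightarrow> A \<in> sets (M i) \<Longrightarrow>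
      emeasure (M i) (T i -` A \<inter> space (M i)) = ennreal (c i) * emeasure (M i) A"
    and A: "A \<in> sets (PiM I M)"
  shows "emeasure (PiM I M) ((\<lambda>x. \<lambda>i\<in>I. T i (x i)) -` A \<inter> space (PiM I M)) =
    ennreal (\<Prod>i\<in>I. c i) * emeasure (PiM I M) A"
proof -
  define S where "S = (\<lambda>x. \<lambda>i\<in>I. T i (x i))"
  define C where "C = (\<Prod>i\<in>I. c i)"
  have C: "0 < C" using c by (simp add: C_def prod_pos)
  have S: "S \<in> measurable (PiM I M) (PiM I M)"
    unfolding S_def
    by (rule measurable_restrict, rule measurable_compose[OF measurable_component_singleton], assumption, rule T)
  \<comment> \<open>Dividing the push-forward by \<open>C\<close> makes it equal to the product
    measure itself, the form that uniqueness on boxes delivers.\<close>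
  have "scale_measure (ennreal (inverse C)) (distr (PiM I M) (PiM I M) S) = PiM I M"
  proof (rule PiM_eqI[OF I])
    fix A assume A: "\<And>i. i \<in> I \<Longrightarrow> A i \<in> sets (M i)"
    have "S -` Pi\<^sub>E I A \<inter> space (PiM I M) = Pi\<^sub>E I (\<lambda>i. T i -` A i \<inter> space (M i))"
      by (auto simp: S_def space_PiM PiE_iff)
    then have "emeasure (distr (PiM I M) (PiM I M) S) (Pi\<^sub>E I A) =
        (\<Prod>i\<in>I. emeasure (M i) (T i -` A i \<inter> space (M i)))"
      using S A I by (subst emeasure_distr) (auto intro!: sets_PiM_I_finite emeasure_PiM)
    also have "\<dots> = (\<Prod>i\<in>I. ennreal (c i) * emeasure (M i) (A i))"
      using A by (intro prod.cong) (simp_all add: scale)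
    also have "\<dots> = ennreal C * (\<Prod>i\<in>I. emeasure (M i) (A i))"
      using c by (simp add: prod.distrib C_def prod_ennreal less_imp_le)
    finally show "emeasure (scale_measure (ennreal (inverse C)) (distr (PiM I M) (PiM I M) S)) (Pi\<^sub>E I A) =
        (\<Prod>i\<in>I. emeasure (M i) (A i))"
      using C by (simp add: mult.assoc[symmetric] ennreal_mult[symmetric])
  qed simp
  then have "ennreal C * emeasure (PiM I M) A =
      ennreal C * emeasure (scale_measure (ennreal (inverse C)) (distr (PiM I M) (PiM I M) S)) A"
    by simp
  also have "\<dots> = emeasure (PiM I M) (S -` A \<inter> space (PiM I M))"
    using C S A by (simp add: mult.assoc[symmetric] ennreal_mult[symmetric] emeasure_distr)
  finally show ?thesis
    by (simp add: S_def C_def)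
qed

section \<open>Scaling of Lebesgue measure on a single Heisenberg group\<close>

lemma emeasure_lborel_vimage_mult:
  fixes r :: real
  assumes "0 < r" "A \<in> sets lborel"
  shows "emeasure lborel ((*) r -` A \<inter> space lborel) = ennreal (inverse r) * emeasure lborel A"
proof -
  have "emeasure lborel ((*) r -` A \<inter> space lborel) = emeasure (distr lborel borel ((*) r)) A"
    using assms by (subst emeasure_distr) auto
  then show ?thesis
    using assms by (simp add: lborel_distr_mult emeasure_density nn_integral_cmult_indicator)
qed

abbreviation heis_lborel :: "nat \<Rightarrow> (nat \<Rightarrow> real) measure" where
  "heis_lborel n \<equiv> PiM {..<2 * n + 1} (\<lambda>_. lborel)"

lemma sigma_finite_PiM_lborel: "finite I \<Longrightarrow> sigma_finite_measure (PiM I (\<lambda>_. lborel :: real measure))"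
proof -
  assume "finite I"
  interpret product_sigma_finite "\<lambda>_ :: 'a. lborel :: real measure" ..
  show ?thesis by (rule sigma_finite) fact
qed

lemma product_sigma_finite_heis: "product_sigma_finite (\<lambda>i. heis_lborel (n i))"
  by (simp add: product_sigma_finite_def sigma_finite_PiM_lborel)

lemma measurable_dilation [measurable]: "dilation n r \<in> measurable (heis_lborel n) (heis_lborel n)"
  unfolding dilation_def by measurable

text \<open>A dilation is diagonal: 2n coordinates contribute a factor r each and the central one
  contributes r^2, which adds up to the homogeneous dimension 2n + 2.\<close>

lemma emeasure_dilation_vimage:
  assumes r: "0 < r" and A: "A \<in> sets (heis_lborel n)"
  shows "emeasure (heis_lborel n) (dilation n (inverse r) -` A \<inter> space (heis_lborel n)) =
    ennreal (r ^ hom_dim n) * emeasure (heis_lborel n) A"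
proof -
  interpret product_sigma_finite "\<lambda>_ :: nat. lborel :: real measure" ..
  define s where "s j = (if j < 2 * n then inverse r else (inverse r)\<^sup>2)" for j
  have s: "0 < s j" for j using r by (simp add: s_def)
  have "dilation n (inverse r) = (\<lambda>x. \<lambda>j\<in>{..<2 * n + 1}. s j * x j)"
    by (auto simp: dilation_def s_def fun_eq_iff)
  then have "emeasure (heis_lborel n) (dilation n (inverse r) -` A \<inter> space (heis_lborel n)) =
      ennreal (\<Prod>j<2 * n + 1. inverse (s j)) * emeasure (heis_lborel n) A"
    using s A emeasure_lborel_vimage_mult
    by (simp only:) (rule emeasure_PiM_map[where T = "\<lambda>j. (*) (s j)"]; simp)
  also have "(\<Prod>j<2 * n + 1. inverse (s j)) = r ^ hom_dim n"
    by (simp add: s_def hom_dim_def power_inverse power_add[symmetric])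
  finally show ?thesis .
qed

section \<open>The uncompleted product measure and joint dilations\<close>

definition heis_prod_borel :: "nat \<Rightarrow> (nat \<Rightarrow> nat) \<Rightarrow> (nat \<Rightarrow> nat \<Rightarrow> real) measure" where
  "heis_prod_borel m n = PiM {..<m} (\<lambda>i. heis_lborel (n i))"

definition prod_dilation ::
    "nat \<Rightarrow> (nat \<Rightarrow> nat) \<Rightarrow> (nat \<Rightarrow> real) \<Rightarrow> (nat \<Rightarrow> nat \<Rightarrow> real) \<Rightarrow> nat \<Rightarrow> nat \<Rightarrow> real" where
  "prod_dilation m n t x = (\<lambda>i\<in>{..<m}. dilation (n i) (inverse (t i)) (x i))"

text \<open>For positive \<open>t i\<close> this is the Jacobian of the inverse of
  \<open>prod_dilation m n t\<close>, which dilates by 1 / \<open>t i\<close>.\<close>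

definition jacobian :: "nat \<Rightarrow> (nat \<Rightarrow> nat) \<Rightarrow> (nat \<Rightarrow> real) \<Rightarrow> real" where
  "jacobian m n t = (\<Prod>i<m. t i ^ hom_dim (n i))"

lemma sigma_finite_heis_prod_borel: "sigma_finite_measure (heis_prod_borel m n)"
proof -
  interpret product_sigma_finite "\<lambda>i. heis_lborel (n i)" by (rule product_sigma_finite_heis)
  show ?thesis unfolding heis_prod_borel_def by (rule sigma_finite) simp
qed

lemma measurable_heis_coordinate:
  assumes "i < m" "j < 2 * n i + 1"
  shows "(\<lambda>x. x i j) \<in> borel_measurable (heis_prod_borel m n)"
proof -
  have "(\<lambda>x. x i) \<in> measurable (heis_prod_borel m n) (heis_lborel (n i))"
    unfolding heis_prod_borel_def using assms by (intro measurable_component_singleton) auto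
  moreover have "(\<lambda>y. y j) \<in> measurable (heis_lborel (n i)) lborel"
    using assms by (intro measurable_component_singleton) auto
  ultimately have "(\<lambda>x. x i j) \<in> measurable (heis_prod_borel m n) lborel"
    by (rule measurable_compose)
  then show ?thesis by simp
qed

text \<open>Joint measurability, as Tonelli needs it, is checked coordinate by coordinate;
  \<open>inverse\<close> is Borel on the whole line with value 0 at 0.\<close>

lemma measurable_prod_dilation:
  "(\<lambda>(t, x). prod_dilation m n t x) \<in>
    measurable (PiM {..<m} (\<lambda>_. lborel) \<Otimes>\<^sub>M heis_prod_borel m n) (heis_prod_borel m n)"
proof -
  have "(\<lambda>p. \<lambda>i\<in>{..<m}. \<lambda>j\<in>{..<2 * n i + 1}.
      if j < 2 * n i then inverse (fst p i) * snd p i j else (inverse (fst p i))\<^sup>2 * snd p i j) \<in>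
    measurable (PiM {..<m} (\<lambda>_. lborel :: real measure) \<Otimes>\<^sub>M heis_prod_borel m n) (PiM {..<m} (\<lambda>i. heis_lborel (n i)))"
  proof (intro measurable_restrict)
    fix i j assume ij: "i \<in> {..<m}" "j \<in> {..<2 * n i + 1}"
    have [measurable]: "(\<lambda>p. snd p i j) \<in>
        borel_measurable (PiM {..<m} (\<lambda>_. lborel :: real measure) \<Otimes>\<^sub>M heis_prod_borel m n)"
      using ij by (intro measurable_compose[OF measurable_snd measurable_heis_coordinate]) auto
    have [measurable]: "(\<lambda>p. fst p i) \<in>
        borel_measurable (PiM {..<m} (\<lambda>_. lborel :: real measure) \<Otimes>\<^sub>M heis_prod_borel m n)"
      using ij by measurable
    show "(\<lambda>p. if j < 2 * n i then inverse (fst p i) * snd p i j else (inverse (fst p i))\<^sup>2 * snd p i j) \<in>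
        measurable (PiM {..<m} (\<lambda>_. lborel) \<Otimes>\<^sub>M heis_prod_borel m n) lborel"
      by measurable
  qed
  then show ?thesis
    by (simp add: prod_dilation_def dilation_def split_beta' heis_prod_borel_def)
qed

lemma emeasure_prod_dilation_vimage:
  assumes t: "\<And>i. i < m \<Longrightarrow> 0 < t i" and A: "A \<in> sets (heis_prod_borel m n)"
  shows "emeasure (heis_prod_borel m n) (prod_dilation m n t -` A \<inter> space (heis_prod_borel m n)) =
    ennreal (jacobian m n t) * emeasure (heis_prod_borel m n) A"
proof -
  interpret product_sigma_finite "\<lambda>i. heis_lborel (n i)" by (rule product_sigma_finite_heis)
  have "prod_dilation m n t = (\<lambda>x. \<lambda>i\<in>{..<m}. dilation (n i) (inverse (t i)) (x i))"
    by (simp add: prod_dilation_def fun_eq_iff)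
  then show ?thesis
    using A t unfolding heis_prod_borel_def jacobian_def
    by (simp only:)
      (rule emeasure_PiM_map, auto intro!: emeasure_dilation_vimage measurable_dilation
        simp del: One_nat_def add_Suc_right)
qed

text \<open>
  Replaces \<open>\<phi>\<close>, which is only Lebesgue measurable, by a Borel function, so that Tonelli applies,
  and discards the null set where some \<open>t i\<close> vanishes.
\<close>
lemma unit_cube_density:
  assumes \<phi>: "\<phi> \<in> borel_measurable (unit_cube m)"
  obtains \<psi> where "\<psi> \<in> borel_measurable (PiM {..<m} (\<lambda>_. lborel))"
    and "\<And>t i. \<psi> t \<noteq> 0 \<Longrightarrow> i < m \<Longrightarrow> 0 < t i \<and> t i \<le> 1"
    and "\<And>G. (\<integral>\<^sup>+ t. ennreal (\<phi> t) * G t \<partial>unit_cube m) = (\<integral>\<^sup>+ t. \<psi> t * G t \<partial>PiM {..<m} (\<lambda>_. lborel))"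
proof -
  interpret product_sigma_finite "\<lambda>_ :: nat. lborel :: real measure" ..
  define U where "U = PiM {..<m} (\<lambda>_. lborel :: real measure)"
  define Q :: "(nat \<Rightarrow> real) set" where "Q = {..<m} \<rightarrow>\<^sub>E {0..1}"
  define R where "R = {t \<in> space U. \<forall>i\<in>{..<m}. 0 < t i \<and> t i \<le> 1}"
  have Q: "Q \<in> sets U"
    unfolding Q_def U_def by (rule sets_PiM_I_finite) auto
  have R [measurable]: "R \<in> sets U"
    unfolding R_def U_def by measurable
  have unit_cube: "unit_cube m = restrict_space (completion U) Q"
    by (simp add: unit_cube_def U_def Q_def)
  \<comment> \<open>Extending \<phi> by 0 outside the cube gives a function on the whole completed
    space, which has a Borel representative.\<close>
  have "(\<lambda>t. ennreal (\<phi> t) * indicator Q t) \<in> borel_measurable (completion U)"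
    using \<phi> Q unfolding unit_cube
    by (subst borel_measurable_restrict_space_iff_ennreal[symmetric]) auto
  then obtain \<psi> where \<psi> [measurable]: "\<psi> \<in> borel_measurable U"
    and ae: "AE t in U. ennreal (\<phi> t) * indicator Q t = \<psi> t"
    using completion_ex_borel_measurable by blast
  \<comment> \<open>The hyperplane where coordinate i vanishes is a box with one side {0}, hence of
    measure 0.\<close>
  have nz: "AE t in U. t i \<noteq> 0" if i: "i < m" for i
  proof (rule AE_I[where N = "Pi\<^sub>E {..<m} (\<lambda>j. if j = i then {0} else UNIV)"])
    show "{t \<in> space U. \<not> t i \<noteq> 0} \<subseteq> Pi\<^sub>E {..<m} (\<lambda>j. if j = i then {0} else UNIV)"
      by (auto simp: U_def space_PiM PiE_iff extensional_def)
    show "emeasure U (Pi\<^sub>E {..<m} (\<lambda>j. if j = i then {0} else UNIV)) = 0"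
      unfolding U_def using i by (subst emeasure_PiM) auto
    show "Pi\<^sub>E {..<m} (\<lambda>j. if j = i then {0} else UNIV) \<in> sets U"
      unfolding U_def by (rule sets_PiM_I_finite) auto
  qed
  have "AE t in U. \<forall>i\<in>{..<m}. t i \<noteq> 0"
    by (rule AE_finite_allI) (use nz in auto)
  then have key: "AE t in U. ennreal (\<phi> t) * indicator Q t = \<psi> t * indicator R t"
    using ae AE_space
  proof eventually_elim
    case (elim t)
    have "t \<in> R" if "t \<in> Q"
      using that elim by (force simp: Q_def R_def PiE_iff less_le)
    then show ?case
      using elim(2) by (cases "t \<in> Q"; cases "t \<in> R") auto
  qed
  show ?thesis
  proof (rule that[of "\<lambda>t. \<psi> t * indicator R t"])
    show "(\<lambda>t. \<psi> t * indicator R t) \<in> borel_measurable (PiM {..<m} (\<lambda>_. lborel))"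
      unfolding U_def[symmetric] by measurable
    show "0 < t i \<and> t i \<le> 1" if "\<psi> t * indicator R t \<noteq> 0" "i < m" for t i
      using that by (auto simp: R_def indicator_def split: if_splits)
    \<comment> \<open>\<open>G\<close> is arbitrary: only the density changes, on a null set. This
      lets \<open>G\<close> contain a test function that is merely Lebesgue measurable.\<close>
    fix G :: "(nat \<Rightarrow> real) \<Rightarrow> ennreal"
    have "(\<integral>\<^sup>+ t. ennreal (\<phi> t) * G t \<partial>unit_cube m) = (\<integral>\<^sup>+ t. (ennreal (\<phi> t) * indicator Q t) * G t \<partial>U)"
      using Q unfolding unit_cube
      by (subst nn_integral_restrict_space) (auto simp: nn_integral_completion mult_ac)
    also have "\<dots> = (\<integral>\<^sup>+ t. (\<psi> t * indicator R t) * G t \<partial>U)"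
      using key by (intro nn_integral_cong_AE, eventually_elim) simp
    finally show "(\<integral>\<^sup>+ t. ennreal (\<phi> t) * G t \<partial>unit_cube m) =
        (\<integral>\<^sup>+ t. \<psi> t * indicator R t * G t \<partial>PiM {..<m} (\<lambda>_. lborel))"
      by (simp add: U_def)
  qed
qed

subsection \<open>Test functions\<close>

text \<open>The integrand is positive everywhere. On the half-line its primitive (1+x)^(1-b)/(1-b)
  tends to 0 because b > 1, and reflection covers the negative half-line.\<close>

lemma nn_integral_one_plus_abs_powr:
  fixes b :: real
  assumes b: "1 < b"
  shows "0 < (\<integral>\<^sup>+ x. ennreal ((1 + \<bar>x\<bar>) powr - b) \<partial>lborel)"
    and "(\<integral>\<^sup>+ x. ennreal ((1 + \<bar>x\<bar>) powr - b) \<partial>lborel) < \<infinity>"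
proof -
  let ?f = "\<lambda>x :: real. ennreal ((1 + \<bar>x\<bar>) powr - b)"
  let ?g = "\<lambda>x :: real. ennreal ((1 + x) powr - b) * indicator {0..} x"
  have "(\<integral>\<^sup>+ x. ?f x \<partial>lborel) \<noteq> 0"
  proof
    assume "(\<integral>\<^sup>+ x. ?f x \<partial>lborel) = 0"
    then have "AE x in lborel. ?f x = 0"
      by (subst (asm) nn_integral_0_iff_AE) auto
    then have "AE x in (lborel :: real measure). False"
      by eventually_elim (simp add: ennreal_eq_0_iff)
    then show False
      by (subst (asm) AE_iff_measurable[where N = UNIV]) auto
  qed
  then show "0 < (\<integral>\<^sup>+ x. ?f x \<partial>lborel)" by (simp only: zero_less_iff_neq_zero not_False_eq_True)
  have "((\<lambda>x. (1 + x) powr (1 - b) / (1 - b)) \<longlongrightarrow> 0) at_top"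
    using b by (auto intro!: tendsto_divide_zero tendsto_neg_powr filterlim_tendsto_add_at_top
        tendsto_const filterlim_ident)
  moreover have "((\<lambda>x. (1 + x) powr (1 - b) / (1 - b)) has_real_derivative (1 + x) powr - b) (at x)"
    if "0 \<le> x" for x
  proof -
    have "((\<lambda>x. (1 + x) powr (1 - b)) has_real_derivative (1 - b) * (1 + x) powr (1 - b - of_nat 1) * 1) (at x)"
      using that by (intro DERIV_fun_powr) (auto intro!: derivative_eq_intros)
    from DERIV_cdivide[OF this, of "1 - b"] show ?thesis
      using b by simp
  qed
  ultimately have g: "(\<integral>\<^sup>+ x. ?g x \<partial>lborel) = ennreal (0 - (1 + 0) powr (1 - b) / (1 - b))"
    by (intro nn_integral_FTC_atLeast) auto
  \<comment> \<open>Only an inequality pointwise, since both half-lines contain 0.\<close>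
  have "(\<integral>\<^sup>+ x. ?f x \<partial>lborel) \<le> (\<integral>\<^sup>+ x. ?g x + ?g (0 + -1 * x) \<partial>lborel)"
    by (intro nn_integral_mono) (auto simp: indicator_def abs_if)
  also have "\<dots> = (\<integral>\<^sup>+ x. ?g x \<partial>lborel) + (\<integral>\<^sup>+ x. ?g (0 + -1 * x) \<partial>lborel)"
    by (rule nn_integral_add) auto
  also have "(\<integral>\<^sup>+ x. ?g (0 + -1 * x) \<partial>lborel) = (\<integral>\<^sup>+ x. ?g x \<partial>lborel)"
    by (subst nn_integral_real_affine[where c = "-1" and t = 0 and f = ?g]) auto
  also have "(\<integral>\<^sup>+ x. ?g x \<partial>lborel) + (\<integral>\<^sup>+ x. ?g x \<partial>lborel) < \<infinity>"
    by (simp add: g)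
  finally show "(\<integral>\<^sup>+ x. ?f x \<partial>lborel) < \<infinity>" .
qed

text \<open>The product over all real coordinates lets integrals factor into one-dimensional ones
  and lets each coordinate be rescaled on its own.\<close>

definition test_fun :: "nat \<Rightarrow> (nat \<Rightarrow> nat) \<Rightarrow> real \<Rightarrow> (nat \<Rightarrow> nat \<Rightarrow> real) \<Rightarrow> real" where
  "test_fun m n a x = (\<Prod>i<m. \<Prod>j<2 * n i + 1. (1 + \<bar>x i j\<bar>) powr - a)"

lemma test_fun_pos: "0 < test_fun m n a x"
  unfolding test_fun_def by (intro prod_pos) auto

lemma measurable_test_fun [measurable]: "test_fun m n a \<in> borel_measurable (heis_prod_borel m n)"
  unfolding test_fun_def[abs_def]
proof (intro borel_measurable_prod)
  fix i j assume "i \<in> {..<m}" "j \<in> {..<2 * n i + 1}"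
  then have [measurable]: "(\<lambda>x. x i j) \<in> borel_measurable (heis_prod_borel m n)"
    by (intro measurable_heis_coordinate) auto
  show "(\<lambda>x. (1 + \<bar>x i j\<bar>) powr - a) \<in> borel_measurable (heis_prod_borel m n)"
    by measurable
qed

text \<open>Reduces L^q norms of test functions to plain integrals with exponent
  \<open>a * q\<close>.\<close>

lemma test_fun_powr: "test_fun m n a x powr q = test_fun m n (a * q) x"
  unfolding test_fun_def
  by (simp add: prod_powr_distrib prod_nonneg powr_powr del: prod.lessThan_Suc)

lemma nn_integral_test_fun:
  assumes b: "1 < b"
  shows "0 < (\<integral>\<^sup>+ x. ennreal (test_fun m n b x) \<partial>heis_prod_borel m n)"
    and "(\<integral>\<^sup>+ x. ennreal (test_fun m n b x) \<partial>heis_prod_borel m n) < \<infinity>"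
proof -
  interpret L: product_sigma_finite "\<lambda>_ :: nat. lborel :: real measure" ..
  interpret H: product_sigma_finite "\<lambda>i. heis_lborel (n i)" by (rule product_sigma_finite_heis)
  define I where "I = (\<integral>\<^sup>+ x. ennreal ((1 + \<bar>x\<bar>) powr - b) \<partial>lborel)"
  have "(\<integral>\<^sup>+ x. ennreal (test_fun m n b x) \<partial>heis_prod_borel m n) =
      (\<integral>\<^sup>+ x. (\<Prod>i<m. \<Prod>j<2 * n i + 1. ennreal ((1 + \<bar>x i j\<bar>) powr - b)) \<partial>PiM {..<m} (\<lambda>i. heis_lborel (n i)))"
    unfolding heis_prod_borel_def test_fun_def
  proof (rule nn_integral_cong)
    fix x :: "nat \<Rightarrow> nat \<Rightarrow> real"
    have "(\<Prod>i<m. \<Prod>j<2 * n i + 1. ennreal ((1 + \<bar>x i j\<bar>) powr - b)) =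
        (\<Prod>i<m. ennreal (\<Prod>j<2 * n i + 1. (1 + \<bar>x i j\<bar>) powr - b))"
      by (intro prod.cong refl prod_ennreal) simp
    also have "\<dots> = ennreal (\<Prod>i<m. \<Prod>j<2 * n i + 1. (1 + \<bar>x i j\<bar>) powr - b)"
      by (intro prod_ennreal prod_nonneg ballI) simp
    finally show "ennreal (\<Prod>i<m. \<Prod>j<2 * n i + 1. (1 + \<bar>x i j\<bar>) powr - b) =
        (\<Prod>i<m. \<Prod>j<2 * n i + 1. ennreal ((1 + \<bar>x i j\<bar>) powr - b))" ..
  qed
  also have "\<dots> = (\<Prod>i<m. \<integral>\<^sup>+ y. (\<Prod>j<2 * n i + 1. ennreal ((1 + \<bar>y j\<bar>) powr - b)) \<partial>heis_lborel (n i))"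
    by (rule H.product_nn_integral_prod) simp_all
  also have "\<dots> = (\<Prod>i<m. \<Prod>j<2 * n i + 1. I)"
    unfolding I_def by (intro prod.cong refl L.product_nn_integral_prod) auto
  finally have eq: "(\<integral>\<^sup>+ x. ennreal (test_fun m n b x) \<partial>heis_prod_borel m n) = (\<Prod>i<m. \<Prod>j<2 * n i + 1. I)" .
  have I: "I \<noteq> 0" "I \<noteq> \<infinity>"
    using nn_integral_one_plus_abs_powr[OF b] unfolding I_def[symmetric] by auto
  have prod: "(\<Prod>i<m. \<Prod>j<2 * n i + 1. I) \<noteq> 0" "(\<Prod>i<m. \<Prod>j<2 * n i + 1. I) \<noteq> \<infinity>"
    using I by (simp_all add: ennreal_prod_eq_top power_eq_top_ennreal_iff ennreal_mult_eq_top_iff)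
  then show "0 < (\<integral>\<^sup>+ x. ennreal (test_fun m n b x) \<partial>heis_prod_borel m n)"
    unfolding eq by (simp only: zero_less_iff_neq_zero not_False_eq_True)
  from prod show "(\<integral>\<^sup>+ x. ennreal (test_fun m n b x) \<partial>heis_prod_borel m n) < \<infinity>"
    unfolding eq by (simp only: less_top infinity_ennreal_def)
qed

text \<open>For s \<le> 1 one has 1 + |y|/s \<le> (1 + |y|)/s; the exponent -a reverses the
  inequality.\<close>

lemma one_plus_abs_scale:
  fixes s y a :: real
  assumes "0 < s" "s \<le> 1" "0 \<le> a"
  shows "s powr a * (1 + \<bar>y\<bar>) powr - a \<le> (1 + \<bar>inverse s * y\<bar>) powr - a"
proof -
  have "1 + \<bar>inverse s * y\<bar> \<le> inverse s * (1 + \<bar>y\<bar>)"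
    using assms by (simp add: abs_mult field_simps)
  then have "(inverse s * (1 + \<bar>y\<bar>)) powr - a \<le> (1 + \<bar>inverse s * y\<bar>) powr - a"
    using assms by (intro powr_mono2') auto
  also have "(inverse s * (1 + \<bar>y\<bar>)) powr - a = s powr a * (1 + \<bar>y\<bar>) powr - a"
    using assms by (subst powr_mult) (auto simp: powr_minus inverse_powr)
  finally show ?thesis .
qed

lemma test_fun_prod_dilation_ge:
  assumes t: "\<And>i. i < m \<Longrightarrow> 0 < t i \<and> t i \<le> 1" and a: "0 \<le> a"
  shows "jacobian m n t powr a * test_fun m n a x \<le> test_fun m n a (prod_dilation m n t x)"
proof -
  define s where "s i j = (if j < 2 * n i then t i else (t i)\<^sup>2)" for i j
  have s: "0 < s i j" "s i j \<le> 1" if "i < m" for i j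
    using t[OF that] by (auto simp: s_def power_le_one)
  \<comment> \<open>The Jacobian as a product over single coordinates: 2n factors \<open>t i\<close>
    and one factor \<open>t i\<close> squared in each group.\<close>
  have J: "jacobian m n t = (\<Prod>i<m. \<Prod>j<2 * n i + 1. s i j)"
    by (simp add: jacobian_def s_def hom_dim_def power_add power2_eq_square mult_ac)
  have "jacobian m n t powr a = (\<Prod>i<m. \<Prod>j<2 * n i + 1. s i j powr a)"
    unfolding J using s
    by (simp add: prod_powr_distrib prod_nonneg less_imp_le del: prod.lessThan_Suc)
  then have "jacobian m n t powr a * test_fun m n a x =
      (\<Prod>i<m. \<Prod>j<2 * n i + 1. s i j powr a * (1 + \<bar>x i j\<bar>) powr - a)"
    unfolding test_fun_def by (simp only: prod.distrib)
  also have "\<dots> \<le> (\<Prod>i<m. \<Prod>j<2 * n i + 1. (1 + \<bar>inverse (s i j) * x i j\<bar>) powr - a)"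
    using s a by (intro prod_mono conjI prod_nonneg one_plus_abs_scale) auto
  also have "\<dots> = test_fun m n a (prod_dilation m n t x)"
    unfolding test_fun_def
    by (intro prod.cong refl) (auto simp: prod_dilation_def dilation_def s_def power_inverse)
  finally show ?thesis .
qed

subsection \<open>The Cesaro operator\<close>

lemma jacobian_pos: "(\<And>i. i < m \<Longrightarrow> 0 < t i) \<Longrightarrow> 0 < jacobian m n t"
  unfolding jacobian_def by (intro prod_pos) auto

lemma measurable_jacobian [measurable]: "jacobian m n \<in> borel_measurable (PiM {..<m} (\<lambda>_. lborel))"
  unfolding jacobian_def[abs_def] by measurable

text \<open>Since -Q(1-e) = Q(e-1), the product is J^(e-1); writing it as J^(-1) J^e separates the
  kernel from the power in \<open>operator_bound e\<close>.\<close>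

lemma prod_powr_eq_jacobian:
  assumes "\<And>i. i < m \<Longrightarrow> 0 < t i"
  shows "(\<Prod>i<m. t i powr (- real (hom_dim (n i)) * (1 - e))) =
    inverse (jacobian m n t) * jacobian m n t powr e"
proof -
  have "(\<Prod>i<m. t i powr (- real (hom_dim (n i)) * (1 - e))) =
      (\<Prod>i<m. (t i ^ hom_dim (n i)) powr (e - 1))"
    using assms by (intro prod.cong refl) (simp add: powr_realpow[symmetric] powr_powr algebra_simps)
  also have "\<dots> = jacobian m n t powr (e - 1)"
    by (simp add: jacobian_def prod_powr_distrib)
  also have "\<dots> = inverse (jacobian m n t) * jacobian m n t powr e"
    using jacobian_pos[of m t n] assms by (simp add: powr_diff field_simps)
  finally show ?thesis .
qed

text \<open>\<psi> stands for the Borel density supplied by \<open>unit_cube_density\<close>; its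
  support condition gives the positivity on which the scaling laws rest.\<close>

locale cesaro_average =
  fixes m :: nat and n :: "nat \<Rightarrow> nat" and \<psi> :: "(nat \<Rightarrow> real) \<Rightarrow> ennreal"
  assumes measurable_density [measurable]: "\<psi> \<in> borel_measurable (PiM {..<m} (\<lambda>_. lborel))"
    and density_support: "\<And>t i. \<psi> t \<noteq> 0 \<Longrightarrow> i < m \<Longrightarrow> 0 < t i \<and> t i \<le> 1"
begin

definition kernel :: "(nat \<Rightarrow> real) \<Rightarrow> ennreal" where
  "kernel t = \<psi> t * ennreal (inverse (jacobian m n t))"

lemma density_kernel: "kernel t \<noteq> 0 \<Longrightarrow> i < m \<Longrightarrow> 0 < t i \<and> t i \<le> 1"
  using density_support by (auto simp: kernel_def)

sublocale dilation_average "PiM {..<m} (\<lambda>_. lborel)" "heis_prod_borel m n" "prod_dilation m n" kernel "jacobian m n"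
proof (intro dilation_average.intro pair_sigma_finite.intro dilation_average_axioms.intro)
  show "sigma_finite_measure (PiM {..<m} (\<lambda>_. lborel :: real measure))"
    by (rule sigma_finite_PiM_lborel) simp
  show "sigma_finite_measure (heis_prod_borel m n)"
    by (rule sigma_finite_heis_prod_borel)
  show "kernel \<in> borel_measurable (PiM {..<m} (\<lambda>_. lborel))"
    unfolding kernel_def[abs_def] by measurable
  show "0 < jacobian m n t" if "kernel t \<noteq> 0" for t
    using density_kernel[OF that] by (intro jacobian_pos) auto
  show "emeasure (heis_prod_borel m n) (prod_dilation m n t -` A \<inter> space (heis_prod_borel m n)) =
      ennreal (jacobian m n t) * emeasure (heis_prod_borel m n) A"
    if "kernel t \<noteq> 0" "A \<in> sets (heis_prod_borel m n)" for t A
    using density_kernel[OF that(1)] that(2) by (intro emeasure_prod_dilation_vimage) auto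
qed (rule measurable_prod_dilation measurable_jacobian)+

text \<open>Integrates the pointwise bound \<open>test_fun_prod_dilation_ge\<close> against the
  kernel, so the test function is almost an eigenfunction from below.\<close>

lemma average_test_fun_ge:
  assumes "0 \<le> a"
  shows "operator_bound a * ennreal (test_fun m n a x) \<le> average (\<lambda>x. ennreal (test_fun m n a x)) x"
proof -
  have "operator_bound a * ennreal (test_fun m n a x) =
      (\<integral>\<^sup>+ t. kernel t * ennreal (jacobian m n t powr a) * ennreal (test_fun m n a x) \<partial>PiM {..<m} (\<lambda>_. lborel))"
    unfolding operator_bound_def by (rule nn_integral_multc[symmetric]) measurable
  also have "\<dots> \<le> average (\<lambda>x. ennreal (test_fun m n a x)) x"
    unfolding average_def
  proof (rule nn_integral_mono)
    fix t :: "nat \<Rightarrow> real"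
    show "kernel t * ennreal (jacobian m n t powr a) * ennreal (test_fun m n a x) \<le>
        kernel t * ennreal (test_fun m n a (prod_dilation m n t x))"
    proof (cases "kernel t = 0")
      case False
      have "jacobian m n t powr a * test_fun m n a x \<le> test_fun m n a (prod_dilation m n t x)"
        using density_kernel[OF False] assms by (intro test_fun_prod_dilation_ge)
      then show ?thesis
        by (simp add: mult.assoc ennreal_mult[symmetric] test_fun_pos less_imp_le mult_left_mono ennreal_leI)
    qed simp
  qed
  finally show ?thesis .
qed

text \<open>Fatou's lemma along exponents decreasing to e, since the integrands converge
  pointwise.\<close>

lemma operator_bound_le_of_Suc:
  assumes "0 \<le> e" and "\<And>k. operator_bound (e + 1 / real (Suc k)) \<le> C"
  shows "operator_bound e \<le> C"
proof -
  define F where "F k t = kernel t * ennreal (jacobian m n t powr (e + 1 / real (Suc k)))" for k t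
  have lim: "(\<lambda>k. F k t) \<longlonglongrightarrow> kernel t * ennreal (jacobian m n t powr e)"
    if t: "t \<in> space (PiM {..<m} (\<lambda>_. lborel :: real measure))" for t
  proof (cases "kernel t = 0")
    case False
    have "(\<lambda>k. e + 1 / real (Suc k)) \<longlonglongrightarrow> e + 0"
      by (intro tendsto_add tendsto_const LIMSEQ_Suc lim_1_over_n)
    then have "(\<lambda>k. ennreal (jacobian m n t powr (e + 1 / real (Suc k)))) \<longlonglongrightarrow> ennreal (jacobian m n t powr e)"
      using J_pos[OF t False] by (intro tendsto_ennrealI tendsto_powr) auto
    then show ?thesis
      unfolding F_def using J_pos[OF t False] by (intro tendsto_mult_ennreal tendsto_const) auto
  qed (simp add: F_def)
  have "operator_bound e = (\<integral>\<^sup>+ t. liminf (\<lambda>k. F k t) \<partial>PiM {..<m} (\<lambda>_. lborel))"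
    unfolding operator_bound_def
    by (intro nn_integral_cong lim_imp_Liminf[symmetric] lim) auto
  also have "\<dots> \<le> liminf (\<lambda>k. \<integral>\<^sup>+ t. F k t \<partial>PiM {..<m} (\<lambda>_. lborel))"
    by (rule nn_integral_liminf) (simp add: F_def)
  also have "\<dots> \<le> C"
    using assms(2) unfolding F_def operator_bound_def[symmetric]
    by (intro Liminf_le) auto
  finally show ?thesis .
qed

end

lemma Lp_nonneg_test_fun:
  assumes p: "1 \<le> p" "p \<noteq> \<infinity>" and a: "exponent_recip p < a"
  shows "test_fun m n a \<in> Lp_nonneg p (completion (heis_prod_borel m n))"
    and "0 < Lp_norm p (completion (heis_prod_borel m n)) (\<lambda>x. ennreal (test_fun m n a x))"
proof -
  define q where "q = enn2real p"
  have q: "1 \<le> q" using p unfolding q_def by (cases p) auto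
  \<comment> \<open>Integrability of the q-th power requires a > 1/q strictly, so the exponent 1/p
    itself is reached only in the limit.\<close>
  have b: "1 < a * q"
    using a q p by (simp add: exponent_recip_def q_def[symmetric] field_simps)
  have eq: "Lp_norm p (completion (heis_prod_borel m n)) (\<lambda>x. ennreal (test_fun m n a x)) =
      ennreal_powr (\<integral>\<^sup>+ x. ennreal (test_fun m n (a * q) x) \<partial>heis_prod_borel m n) (1 / q)"
    using p by (simp add: Lp_norm_def q_def[symmetric] nn_integral_completion test_fun_pos less_imp_le test_fun_powr)
  note int = nn_integral_test_fun[OF b, of m n]
  show "0 < Lp_norm p (completion (heis_prod_borel m n)) (\<lambda>x. ennreal (test_fun m n a x))"
    unfolding eq using int(1) by (simp only: zero_less_iff_neq_zero ennreal_powr_eq_0_iff not_False_eq_True)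
  have "ennreal_powr (\<integral>\<^sup>+ x. ennreal (test_fun m n (a * q) x) \<partial>heis_prod_borel m n) (1 / q) < \<infinity>"
    using int(2) by (auto simp: ennreal_powr_def)
  then show "test_fun m n a \<in> Lp_nonneg p (completion (heis_prod_borel m n))"
    unfolding Lp_nonneg_def eq by (auto simp: test_fun_pos less_imp_le eq intro!: measurable_completion)
qed

lemma heis_prod_eq: "heis_prod m n = completion (heis_prod_borel m n)"
  by (simp add: heis_prod_def heis_prod_borel_def)

text \<open>Needed for the essential supremum of a constant to be that constant. The positive
  integral of \<open>test_fun m n 2\<close> could not exist on a null space.\<close>

lemma emeasure_heis_prod_nonzero: "emeasure (heis_prod m n) (space (heis_prod m n)) \<noteq> 0"
proof
  assume "emeasure (heis_prod m n) (space (heis_prod m n)) = 0"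
  then have "emeasure (heis_prod_borel m n) (space (heis_prod_borel m n)) = 0"
    by (simp add: heis_prod_eq)
  then have "AE x in heis_prod_borel m n. ennreal (test_fun m n 2 x) = 0"
    by (intro AE_I'[of "space (heis_prod_borel m n)"]) auto
  then have "(\<integral>\<^sup>+ x. ennreal (test_fun m n 2 x) \<partial>heis_prod_borel m n) = 0"
    by (subst nn_integral_0_iff_AE) auto
  then show False
    using nn_integral_test_fun(1)[of 2 m n] by simp
qed

theorem theorem3:
  fixes p :: ennreal and m :: nat and n :: "nat \<Rightarrow> nat" and \<phi> :: "(nat \<Rightarrow> real) \<Rightarrow> real"
  assumes "1 \<le> p"
    and "1 \<le> m"
    and "\<And>i. i < m \<Longrightarrow> 1 \<le> n i"
    and "\<phi> \<in> borel_measurable (unit_cube m)"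
    and "\<And>t. t \<in> space (unit_cube m) \<Longrightarrow> 0 \<le> \<phi> t"
  shows "Lp_bounded p (heis_prod m n) (cesaro m n \<phi>) \<longleftrightarrow>
    (\<integral>\<^sup>+ t. ennreal ((\<Prod>i<m. t i powr (- real (hom_dim (n i)) * (1 - exponent_recip p))) * \<phi> t)
       \<partial>unit_cube m) < \<infinity>"
proof -
  define e where "e = exponent_recip p"
  have e: "0 \<le> e" by (simp add: e_def exponent_recip_def)
  obtain \<psi> where \<psi>: "\<psi> \<in> borel_measurable (PiM {..<m} (\<lambda>_. lborel))"
      "\<And>t i. \<psi> t \<noteq> 0 \<Longrightarrow> i < m \<Longrightarrow> 0 < t i \<and> t i \<le> 1"
    and cube: "\<And>G. (\<integral>\<^sup>+ t. ennreal (\<phi> t) * G t \<partial>unit_cube m) = (\<integral>\<^sup>+ t. \<psi> t * G t \<partial>PiM {..<m} (\<lambda>_. lborel))"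
    using unit_cube_density[OF assms(4)] by blast
  interpret cesaro_average m n \<psi>
    by unfold_locales (use \<psi> in auto)
  have cesaro: "cesaro m n \<phi> f x = average (\<lambda>x. ennreal (f x)) x"
    if f: "\<And>x. x \<in> space (heis_prod m n) \<Longrightarrow> 0 \<le> f x" for f x
  proof -
    \<comment> \<open>\<open>prod_dilation\<close> always lands in the space of the product, for any
      x and t, so nonnegativity of \<open>f\<close> on the space suffices.\<close>
    have fD: "0 \<le> f (prod_dilation m n t x)" for t
      by (rule f) (auto simp: space_heis_prod prod_dilation_def dilation_def heisenberg_def)
    have "cesaro m n \<phi> f x =
        (\<integral>\<^sup>+ t. ennreal (\<phi> t) * ennreal (f (prod_dilation m n t x) / jacobian m n t) \<partial>unit_cube m)"
      unfolding cesaro_def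
    proof (rule nn_integral_cong)
      fix t assume t: "t \<in> space (unit_cube m)"
      then have "0 \<le> jacobian m n t"
        unfolding jacobian_def by (intro prod_nonneg) (auto simp: space_unit_cube PiE_iff)
      then show "ennreal (f (\<lambda>i\<in>{..<m}. dilation (n i) (inverse (t i)) (x i)) * \<phi> t / (\<Prod>i<m. t i ^ hom_dim (n i))) =
          ennreal (\<phi> t) * ennreal (f (prod_dilation m n t x) / jacobian m n t)"
        using fD[of t] assms(5)[OF t]
        by (simp add: ennreal_mult[symmetric] prod_dilation_def jacobian_def mult.commute)
    qed
    also have "\<dots> = average (\<lambda>x. ennreal (f x)) x"
      unfolding cube average_def
    proof (rule nn_integral_cong)
      fix t
      show "\<psi> t * ennreal (f (prod_dilation m n t x) / jacobian m n t) =
          kernel t * ennreal (f (prod_dilation m n t x))"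
      proof (cases "\<psi> t = 0")
        case False
        then have "0 < jacobian m n t" using \<psi>(2) by (intro jacobian_pos) auto
        then show ?thesis
          using fD[of t] by (simp add: kernel_def divide_inverse ennreal_mult mult_ac)
      qed (simp add: kernel_def)
    qed
    finally show ?thesis .
  qed
  have "(\<integral>\<^sup>+ t. ennreal ((\<Prod>i<m. t i powr (- real (hom_dim (n i)) * (1 - e))) * \<phi> t) \<partial>unit_cube m) =
      (\<integral>\<^sup>+ t. ennreal (\<phi> t) * ennreal (\<Prod>i<m. t i powr (- real (hom_dim (n i)) * (1 - e))) \<partial>unit_cube m)"
    using assms(5) by (intro nn_integral_cong) (simp add: ennreal_mult[symmetric] prod_nonneg mult.commute)
  also have "\<dots> = operator_bound e"
    unfolding cube operator_bound_def
  proof (rule nn_integral_cong)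
    fix t
    show "\<psi> t * ennreal (\<Prod>i<m. t i powr (- real (hom_dim (n i)) * (1 - e))) =
        kernel t * ennreal (jacobian m n t powr e)"
    proof (cases "\<psi> t = 0")
      case False
      then have pos: "0 < t i" if "i < m" for i using \<psi>(2) that by auto
      then have "0 < jacobian m n t" by (intro jacobian_pos) auto
      moreover have "(\<Prod>i<m. t i powr (- real (hom_dim (n i)) * (1 - e))) =
          inverse (jacobian m n t) * jacobian m n t powr e"
        using pos by (rule prod_powr_eq_jacobian)
      ultimately show ?thesis
        by (simp only:) (simp add: kernel_def mult.assoc ennreal_mult[symmetric])
    qed (simp add: kernel_def)
  qed
  finally have integral: "(\<integral>\<^sup>+ t. ennreal ((\<Prod>i<m. t i powr (- real (hom_dim (n i)) * (1 - e))) * \<phi> t) \<partial>unit_cube m) =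
      operator_bound e" .
  have "Lp_bounded p (heis_prod m n) (cesaro m n \<phi>) \<longleftrightarrow> operator_bound e < \<infinity>"
  proof
    assume W: "operator_bound e < \<infinity>"
    show "Lp_bounded p (heis_prod m n) (cesaro m n \<phi>)"
      unfolding Lp_bounded_def
    proof (intro exI[of _ "operator_bound e"] conjI ballI W)
      fix f assume f: "f \<in> Lp_nonneg p (heis_prod m n)"
      have "cesaro m n \<phi> f = average (\<lambda>x. ennreal (f x))"
        using f by (intro ext cesaro) (auto simp: Lp_nonneg_def)
      then show "Lp_norm p (heis_prod m n) (cesaro m n \<phi> f) \<le>
          operator_bound e * Lp_norm p (heis_prod m n) (\<lambda>x. ennreal (f x))"
        using Lp_norm_average_le[OF assms(1), of "\<lambda>x. ennreal (f x)"] W f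
        by (auto simp: e_def heis_prod_eq Lp_nonneg_def)
    qed
  next
    assume "Lp_bounded p (heis_prod m n) (cesaro m n \<phi>)"
    then obtain C where C: "C < \<infinity>" and bound: "\<And>f. f \<in> Lp_nonneg p (heis_prod m n) \<Longrightarrow>
        Lp_norm p (heis_prod m n) (cesaro m n \<phi> f) \<le> C * Lp_norm p (heis_prod m n) (\<lambda>x. ennreal (f x))"
      unfolding Lp_bounded_def by blast
    have cesaro_test: "cesaro m n \<phi> (test_fun m n a) = average (\<lambda>x. ennreal (test_fun m n a x))" for a
      by (intro ext cesaro) (simp add: test_fun_pos less_imp_le)
    have "operator_bound e \<le> C"
    proof (cases "p = \<infinity>")
      case True
      have e0: "e = 0" using True by (simp add: e_def exponent_recip_def)
      \<comment> \<open>For p = \<infinity> the constant function is available, so the critical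
        exponent 0 is tested directly.\<close>
      have one: "test_fun m n 0 = (\<lambda>_. 1)"
      proof
        fix x :: "nat \<Rightarrow> nat \<Rightarrow> real"
        have "(1 + \<bar>x i j\<bar>) powr - 0 = 1" for i j
          using abs_ge_zero[of "x i j"] by simp
        then show "test_fun m n 0 x = 1"
          unfolding test_fun_def by (simp only: prod.neutral_const)
      qed
      have "test_fun m n 0 \<in> Lp_nonneg p (heis_prod m n)"
        using True by (simp add: Lp_nonneg_def Lp_norm_def one esssup_const[OF emeasure_heis_prod_nonzero])
      from bound[OF this] have "esssup (heis_prod m n) (average (\<lambda>_. 1)) \<le> C"
        unfolding cesaro_test using True
        by (simp add: Lp_norm_def one esssup_const[OF emeasure_heis_prod_nonzero])
      \<comment> \<open>The image of a constant is a constant, so its essential supremum is its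
        value.\<close>
      moreover have "average (\<lambda>_. 1) = (\<lambda>_. \<integral>\<^sup>+ t. kernel t \<partial>PiM {..<m} (\<lambda>_. lborel))"
        by (simp add: average_def fun_eq_iff)
      moreover have "operator_bound 0 \<le> average (\<lambda>_. 1) x" for x
        using average_test_fun_ge[of 0 x] by (simp add: one)
      ultimately show ?thesis
        by (simp add: e0 esssup_const[OF emeasure_heis_prod_nonzero])
    next
      case False
      show ?thesis
      proof (rule operator_bound_le_of_Suc[OF e])
        fix k
        define a where "a = e + 1 / real (Suc k)"
        define N where "N = Lp_norm p (heis_prod m n) (\<lambda>x. ennreal (test_fun m n a x))"
        have a: "exponent_recip p < a" "0 \<le> a" using e by (auto simp: a_def e_def)
        note test = Lp_nonneg_test_fun[OF assms(1) False a(1), of m n, folded heis_prod_eq]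
        \<comment> \<open>Both facts are used to cancel \<open>N\<close> from
          \<open>operator_bound a * N \<le> C * N\<close>.\<close>
        have N: "N \<noteq> 0" "N < \<infinity>"
          using test by (auto simp: N_def Lp_nonneg_def)
        have "operator_bound a * N =
            Lp_norm p (heis_prod m n) (\<lambda>x. operator_bound a * ennreal (test_fun m n a x))"
          unfolding N_def using False assms(1) by (intro Lp_norm_cmult[symmetric])
            (auto simp: heis_prod_eq intro!: measurable_completion)
        also have "\<dots> \<le> Lp_norm p (heis_prod m n) (cesaro m n \<phi> (test_fun m n a))"
          unfolding cesaro_test using False a
          by (intro Lp_norm_mono_AE AE_I2 average_test_fun_ge)
        also have "\<dots> \<le> C * N"
          unfolding N_def by (rule bound[OF test(1)])
        finally show "operator_bound (e + 1 / real (Suc k)) \<le> C"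
          using N unfolding a_def[symmetric] by (auto simp: ennreal_mult_le_mult_iff mult.commute[of _ N])
      qed
    qed
    then show "operator_bound e < \<infinity>"
      using C by (rule le_less_trans)
  qed
  then show ?thesis
    unfolding e_def[symmetric] integral .
qed

end
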